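(* Let $\Gamma$ be a cubic curve and let $P\in\mathcal{H}\Gamma$. Then all the contact points of tangents from $P$ to the curves $\Gamma$ and $\mathcal{H}\Gamma$ are intersection points of $\ell_1^P$ and $\ell_2^P$ with $\Gamma$ and $\mathcal{H}\Gamma$, where $\ell_1^P$ and $\ell_2^P$ are the two lines whose product is the polar conic of $\Gamma$ with respect to the pole $P$. In addition, the intersection $Q$ of $\ell_1^P$ and $\ell_2^P$ lies on $\mathcal{H}\Gamma$.
   Context: Cubic curves are considered in the real projective plane $\mathbb{RP}^2$. Let $f$ be a homogeneous polynomial of degree $3$ in the variables $x_1,x_2,x_3$; it defines the cubic curve $\Gamma=\Gamma_f=\{[X]\in\mathbb{RP}^2 : f(X)=0\}$. Let $H_f=\left(\frac{\partial^2 f}{\partial x_i\partial x_j}\right)$ be the symmetric $3\times 3$ Hesse matrix of $f$. Since $\det(H_f)$ is again a homogeneous cubic polynomial, one defines the Hesse derivative of $\Gamma$ as the cubic curve $\mathcal{H}\Gamma=\{[X]\in\mathbb{RP}^2 : \det(H_f(X))=0\}$. The polar conic of $\Gamma$ with respect to the pole $P$ is given by $\mathcal{C}_f(P):\ \langle X,H_f(P)X\rangle=0$, or equivalently by $\langle\nabla f(X),P\rangle=0$. It is the product of two projective lines if and only if $\det(H_f(P))=0$, i.e. if and only if $P\in\mathcal{H}\Gamma$; in this case the two lines are denoted $\ell_1^P$ and $\ell_2^P$ (the linear factors of the quadratic form may have complex coefficients). A contact point of a tangent from $P$ to $\Gamma$ is a point of $\Gamma$ at which the tangent to $\Gamma$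 passes through $P$. Since $P$ itself lies on $\mathcal{H}\Gamma$, a contact point of a tangent from $P$ to $\mathcal{H}\Gamma$ means a point $R\in\mathcal{H}\Gamma$ such that the tangent to $\mathcal{H}\Gamma$ at $R$ has $P$ as its third intersection point with $\mathcal{H}\Gamma$, counted with multiplicity (in terms of the group law on an elliptic curve $y^2=x^3+ax^2+bx$: $2*R=-P$). *)

theory Defs
  imports "HOL-Analysis.Analysis" "HOL-Computational_Algebra.Polynomial"
begin

section \<open>The projective plane over a field\<close>

text \<open>A point of the projective plane is the set of its nonzero homogeneous coordinate vectors.\<close>

definition proj_pt :: "'a::field ^ 3 \<Rightarrow> ('a ^ 3) set" where
  "proj_pt X = {c *s X | c. c \<noteq> 0}"

definition proj_plane :: "('a::field ^ 3) set set" where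
  "proj_plane = {proj_pt X | X. X \<noteq> 0}"

definition curve :: "('a::field ^ 3 \<Rightarrow> 'a) \<Rightarrow> ('a ^ 3) set set" where
  "curve g = {proj_pt X | X. X \<noteq> 0 \<and> g X = 0}"

definition lin_form :: "'a::field ^ 3 \<Rightarrow> 'a ^ 3 \<Rightarrow> 'a" where
  "lin_form a X = (\<Sum>i\<in>UNIV. a $ i * X $ i)"

definition proj_line :: "'a::field ^ 3 \<Rightarrow> ('a ^ 3) set set" where
  "proj_line a = curve (lin_form a)"

definition complexify :: "real ^ 3 \<Rightarrow> complex ^ 3" where
  "complexify X = (\<chi> i. complex_of_real (X $ i))"

text \<open>The inclusion of the real into the complex projective plane. All members of the
  union are equal when \<open>p\<close> is a real projective point.\<close>

definition complex_pt :: "(real ^ 3) set \<Rightarrow> (complex ^ 3) set" where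
  "complex_pt p = (\<Union>X\<in>p. proj_pt (complexify X))"


section \<open>Cubic forms, Hesse matrix, Hesse derivative\<close>

definition cubic_form :: "(real ^ 3 \<Rightarrow> real) \<Rightarrow> bool" where
  "cubic_form f \<longleftrightarrow>
     (\<exists>c :: nat \<Rightarrow> nat \<Rightarrow> real. \<forall>X. f X =
        (\<Sum>i\<le>3. \<Sum>j\<le>3 - i. c i j * (X $ 1) ^ i * (X $ 2) ^ j * (X $ 3) ^ (3 - i - j))) \<and>
     (\<exists>X. f X \<noteq> 0)"

definition partial_deriv :: "3 \<Rightarrow> (real ^ 3 \<Rightarrow> real) \<Rightarrow> real ^ 3 \<Rightarrow> real" where
  "partial_deriv i g X = deriv (\<lambda>t. g (X + t *\<^sub>R axis i 1)) 0"

definition gradient :: "(real ^ 3 \<Rightarrow> real) \<Rightarrow> real ^ 3 \<Rightarrow> real ^ 3" where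
  "gradient g X = (\<chi> i. partial_deriv i g X)"

definition hesse_matrix :: "(real ^ 3 \<Rightarrow> real) \<Rightarrow> real ^ 3 \<Rightarrow> real ^ 3 ^ 3" where
  "hesse_matrix f X = (\<chi> i j. partial_deriv i (partial_deriv j f) X)"

definition hesse_det :: "(real ^ 3 \<Rightarrow> real) \<Rightarrow> real ^ 3 \<Rightarrow> real" where
  "hesse_det f X = det (hesse_matrix f X)"

definition hesse_derivative :: "(real ^ 3 \<Rightarrow> real) \<Rightarrow> (real ^ 3) set set" where
  "hesse_derivative f = curve (hesse_det f)"


section \<open>Polar conic and its two lines\<close>

text \<open>The bilinear (not Hermitian) extension of \<open>\<langle>X, H\<^sub>f(P) X\<rangle>\<close> to complex \<open>X\<close>: the linear factors
  of this real quadratic form may have complex coefficients.\<close>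

definition polar_form :: "(real ^ 3 \<Rightarrow> real) \<Rightarrow> real ^ 3 \<Rightarrow> complex ^ 3 \<Rightarrow> complex" where
  "polar_form f P X =
     (\<Sum>i\<in>UNIV. \<Sum>j\<in>UNIV. X $ i * complex_of_real (hesse_matrix f P $ i $ j) * X $ j)"

definition polar_conic_lines ::
  "(real ^ 3 \<Rightarrow> real) \<Rightarrow> (real ^ 3) set \<Rightarrow> (complex ^ 3) set set \<Rightarrow> (complex ^ 3) set set \<Rightarrow> bool" where
  "polar_conic_lines f p l\<^sub>1 l\<^sub>2 \<longleftrightarrow>
     (\<exists>P a b. P \<noteq> 0 \<and> p = proj_pt P \<and> a \<noteq> 0 \<and> b \<noteq> 0 \<and>
        l\<^sub>1 = proj_line a \<and> l\<^sub>2 = proj_line b \<and>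
        (\<forall>X. polar_form f P X = lin_form a X * lin_form b X))"


section \<open>Tangents and contact points\<close>

text \<open>A curve has a tangent only at its nonsingular points.\<close>

definition is_tangent ::
  "(real ^ 3 \<Rightarrow> real) \<Rightarrow> (real ^ 3) set \<Rightarrow> (real ^ 3) set set \<Rightarrow> bool" where
  "is_tangent g r l \<longleftrightarrow>
     (\<exists>R. R \<noteq> 0 \<and> r = proj_pt R \<and> g R = 0 \<and> gradient g R \<noteq> 0 \<and> l = proj_line (gradient g R))"

definition contact_pts :: "(real ^ 3 \<Rightarrow> real) \<Rightarrow> (real ^ 3) set \<Rightarrow> (real ^ 3) set set" where
  "contact_pts g p = {r. \<exists>l. is_tangent g r l \<and> p \<in> l}"

text \<open>The line \<open>l\<close> meets the curve \<open>g = 0\<close> at its point \<open>q\<close> with multiplicity exactly \<open>n\<close>: parametrize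
  \<open>l\<close> near \<open>q\<close> by \<open>t \<mapsto> Q + t V\<close> and take the order of vanishing of \<open>g\<close> at \<open>t = 0\<close>. The
  requirement \<open>h \<noteq> 0\<close> means that \<open>l\<close> is not a component of the curve; in that case no
  multiplicity is defined.\<close>

definition intersection_mult ::
  "(real ^ 3 \<Rightarrow> real) \<Rightarrow> (real ^ 3) set set \<Rightarrow> (real ^ 3) set \<Rightarrow> nat \<Rightarrow> bool" where
  "intersection_mult g l q n \<longleftrightarrow>
     (\<exists>Q V h. Q \<noteq> 0 \<and> V \<noteq> 0 \<and> q = proj_pt Q \<and> q \<in> l \<and> proj_pt V \<in> l \<and> proj_pt V \<noteq> q \<and>
        h \<noteq> 0 \<and> (\<forall>t. poly h t = g (Q + t *\<^sub>R V)) \<and> order 0 h = n)"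

text \<open>Contact points of tangents from a point \<open>p\<close> of the cubic \<open>g = 0\<close> itself: \<open>p\<close> is the
  third intersection point, with multiplicity, of the tangent \<open>l\<close> at \<open>r\<close>. That is, \<open>l\<close> cuts the cubic in the
  divisor \<open>2 r + p\<close>. For \<open>r = p\<close> this says that \<open>p\<close> is an inflection point.\<close>

definition third_contact_pts :: "(real ^ 3 \<Rightarrow> real) \<Rightarrow> (real ^ 3) set \<Rightarrow> (real ^ 3) set set" where
  "third_contact_pts g p =
     {r. \<exists>l. is_tangent g r l \<and> p \<in> l \<and>
           (\<forall>q\<in>l. intersection_mult g l q (2 * of_bool (q = r) + of_bool (q = p)))}"

end

theory Submission
  imports Defs
begin

text \<open>
  The Hesse matrix \<open>H(X)\<close> of \<open>f\<close> depends linearly on \<open>X\<close>, and \<open>T(X, Y, Z) = \<langle>Y, H(X) Z\<rangle>\<close> is a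
  symmetric trilinear form with \<open>T(P, R, R) = 2 \<langle>\<nabla>f(R), P\<rangle>\<close>; this settles tangents to \<open>\<Gamma>\<close>. The lines
  meet in the kernel \<open>Q\<close> of \<open>H(P)\<close>, and \<open>H(Q) P = H(P) Q = 0\<close>.

  For a tangent to the Hesse derivative at \<open>R\<close>, let \<open>S\<close> span the kernel of \<open>H(R)\<close>. The adjugate of
  \<open>H(R)\<close> is a multiple of \<open>S S\<^sup>T\<close>, so the tangent is \<open>T(S, S, X) = 0\<close>. Since \<open>H(S) R = 0\<close>, the point
  \<open>S\<close> lies on the Hesse derivative; if it also lies on the tangent, then it is \<open>R\<close> or \<open>P\<close>, and
  \<open>T(P, R, R) = 0\<close> follows. Otherwise, for \<open>V\<close> a second point of the tangent, \<open>S, R, V\<close> is a basis,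
  in which \<open>det H(x R + y V)\<close> is a nonzero multiple of
  \<open>y\<^sup>2 T(V, S, V)\<^sup>2 (x T(R, R, R) + y T(V, R, R))\<close>. The residual intersection point
  is thus the zero of \<open>X \<mapsto> T(X, R, R)\<close>.
\<close>

section \<open>Homogeneous coordinates\<close>

lemma proj_pt_eq_iff: "proj_pt X = proj_pt Y \<longleftrightarrow> (\<exists>c. c \<noteq> 0 \<and> X = c *s Y)"
proof
  assume "proj_pt X = proj_pt Y"
  moreover have "X \<in> proj_pt X"
    unfolding proj_pt_def by (auto intro!: exI[of _ 1])
  ultimately show "\<exists>c. c \<noteq> 0 \<and> X = c *s Y"
    unfolding proj_pt_def by auto
next
  assume "\<exists>c. c \<noteq> 0 \<and> X = c *s Y"
  then obtain c where c: "c \<noteq> 0" "X = c *s Y" by blast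
  show "proj_pt X = proj_pt Y"
  proof (intro equalityI subsetI)
    fix Z assume "Z \<in> proj_pt X"
    then show "Z \<in> proj_pt Y"
      using c unfolding proj_pt_def by (force simp: vector_smult_assoc)
  next
    fix Z assume "Z \<in> proj_pt Y"
    then obtain d where d: "d \<noteq> 0" "Z = d *s Y" unfolding proj_pt_def by blast
    then have "Z = (d / c) *s X" "d / c \<noteq> 0" using c by (simp_all add: vector_smult_assoc)
    then show "Z \<in> proj_pt X" unfolding proj_pt_def by blast
  qed
qed

lemma proj_pt_eqE:
  fixes X Y :: "real ^ 3"
  assumes "proj_pt X = proj_pt Y"
  obtains c where "c \<noteq> 0" "X = c *\<^sub>R Y"
  using assms unfolding proj_pt_eq_iff scalar_mult_eq_scaleR by blast

text \<open>Homogeneity of \<open>g\<close> makes its vanishing independent of the chosen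
  representative.\<close>

lemma proj_pt_mem_curve_iff:
  assumes "\<And>c X. g (c *s X) = c ^ n * g X" and "X \<noteq> 0"
  shows "proj_pt X \<in> curve g \<longleftrightarrow> g X = 0"
proof
  assume "proj_pt X \<in> curve g"
  then obtain Y where "proj_pt X = proj_pt Y" "g Y = 0" unfolding curve_def by blast
  then show "g X = 0" by (auto simp: proj_pt_eq_iff assms(1))
qed (use assms(2) in \<open>auto simp: curve_def\<close>)

lemma lin_form_scale: "lin_form a (c *s X) = c * lin_form a X"
  by (simp add: lin_form_def sum_distrib_left mult_ac)

lemma lin_form_add: "lin_form a (X + Y) = lin_form a X + lin_form a Y"
  by (simp add: lin_form_def sum.distrib distrib_left)

lemma lin_form_axis: "lin_form a (axis i 1) = a $ i"
  by (simp add: lin_form_def axis_def if_distrib cong: if_cong)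

lemma lin_form_real: "lin_form a X = a \<bullet> X"
  by (simp add: lin_form_def inner_vec_def)

lemma proj_pt_mem_line_iff: "X \<noteq> 0 \<Longrightarrow> proj_pt X \<in> proj_line a \<longleftrightarrow> lin_form a X = 0"
  unfolding proj_line_def by (rule proj_pt_mem_curve_iff[where n = 1]) (simp_all add: lin_form_scale)

lemma complexify_eq_0_iff: "complexify X = 0 \<longleftrightarrow> X = 0"
  by (simp add: complexify_def vec_eq_iff)

lemma complex_pt_proj_pt: "complex_pt (proj_pt X) = proj_pt (complexify X)"
proof -
  have "proj_pt (complexify (c *s X)) = proj_pt (complexify X)" if "c \<noteq> 0" for c
    unfolding proj_pt_eq_iff using that
    by (intro exI[of _ "complex_of_real c"]) (simp add: complexify_def vec_eq_iff)
  then have "proj_pt (complexify Y) = proj_pt (complexify X)" if "Y \<in> proj_pt X" for Y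
    using that unfolding proj_pt_def by blast
  moreover have "X \<in> proj_pt X"
    unfolding proj_pt_def by (auto intro!: exI[of _ 1])
  ultimately show ?thesis unfolding complex_pt_def by blast
qed

text \<open>The cross product of \<open>a\<close> and \<open>b\<close> is proportional to both \<open>X\<close> and \<open>Y\<close>.\<close>

lemma lines_meet_once:
  fixes a b X Y :: "'a::field ^ 3"
  assumes ne: "proj_line a \<noteq> proj_line b" and nz: "a \<noteq> 0" "b \<noteq> 0" "X \<noteq> 0" "Y \<noteq> 0"
    and van: "lin_form a X = 0" "lin_form b X = 0" "lin_form a Y = 0" "lin_form b Y = 0"
  shows "proj_pt X = proj_pt Y"
proof -
  define w1 where "w1 = a$2 * b$3 - a$3 * b$2"
  define w2 where "w2 = a$3 * b$1 - a$1 * b$3"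
  define w3 where "w3 = a$1 * b$2 - a$2 * b$1"
  \<comment> \<open>If the cross product vanished, \<open>a\<close> and \<open>b\<close> would be
    proportional and would define the same line.\<close>
  have w: "w1 \<noteq> 0 \<or> w2 \<noteq> 0 \<or> w3 \<noteq> 0"
  proof (rule ccontr)
    assume "\<not> ?thesis"
    then have w0: "a$2 * b$3 = a$3 * b$2" "a$3 * b$1 = a$1 * b$3" "a$1 * b$2 = a$2 * b$1"
      by (auto simp: w1_def w2_def w3_def)
    obtain i where i: "a $ i \<noteq> 0" using nz by (auto simp: vec_eq_iff)
    have ab: "a $ i * b $ j = b $ i * a $ j" for j
      using w0 exhaust_3[of i] exhaust_3[of j] by (auto simp: mult_ac)
    have b: "b = (b $ i / a $ i) *s a"
      using i ab by (simp add: vec_eq_iff field_simps)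
    then have k: "b $ i / a $ i \<noteq> 0" using nz by (metis vec.scale_zero_left)
    have "lin_form b Z = (b $ i / a $ i) * lin_form a Z" for Z
      by (subst b) (simp add: lin_form_def sum_distrib_left mult_ac)
    then have "lin_form b Z = 0 \<longleftrightarrow> lin_form a Z = 0" for Z
      using k by simp
    then show False using ne unfolding proj_line_def curve_def by simp
  qed
  \<comment> \<open>The double cross product (a x b) x Z equals (a.Z) b - (b.Z) a, which vanishes
    here.\<close>
  have key: "w1 * Z$2 = w2 * Z$1 \<and> w2 * Z$3 = w3 * Z$2 \<and> w3 * Z$1 = w1 * Z$3"
    if "lin_form a Z = 0" "lin_form b Z = 0" for Z
    using that unfolding lin_form_def sum_3 w1_def w2_def w3_def by algebra
  define W :: "'a ^ 3" where "W = vector [w1, w2, w3]"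
  have Wk: "W $ i * Z $ j = W $ j * Z $ i" if "lin_form a Z = 0" "lin_form b Z = 0" for Z i j
    using key[OF that] exhaust_3[of i] exhaust_3[of j] by (auto simp: W_def)
  obtain i where i: "W $ i \<noteq> 0" using w unfolding W_def by (metis vector_3)
  have Wprop: "Z = (Z $ i / W $ i) *s W" if "lin_form a Z = 0" "lin_form b Z = 0" for Z
    using Wk[OF that] i by (simp add: vec_eq_iff field_simps)
  have "proj_pt Z = proj_pt W" if "lin_form a Z = 0" "lin_form b Z = 0" "Z \<noteq> 0" for Z
    using Wprop[OF that(1,2)] \<open>Z \<noteq> 0\<close> unfolding proj_pt_eq_iff by (metis vec.scale_zero_left)
  with van nz show ?thesis by metis
qed

section \<open>Determinants of order three\<close>

text \<open>The cofactors of \<open>A\<close> paired with the entries of \<open>B\<close>, that is,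
  the trace of adj(A) B. By Jacobi's formula this is the derivative of the determinant at
  \<open>A\<close> in direction \<open>B\<close>.\<close>

definition det_deriv :: "real ^ 3 ^ 3 \<Rightarrow> real ^ 3 ^ 3 \<Rightarrow> real" where
  "det_deriv A B =
     (A$2$2 * A$3$3 - A$2$3 * A$3$2) * B$1$1 + (A$2$3 * A$3$1 - A$2$1 * A$3$3) * B$1$2 +
     (A$2$1 * A$3$2 - A$2$2 * A$3$1) * B$1$3 + (A$1$3 * A$3$2 - A$1$2 * A$3$3) * B$2$1 +
     (A$1$1 * A$3$3 - A$1$3 * A$3$1) * B$2$2 + (A$1$2 * A$3$1 - A$1$1 * A$3$2) * B$2$3 +
     (A$1$2 * A$2$3 - A$1$3 * A$2$2) * B$3$1 + (A$1$3 * A$2$1 - A$1$1 * A$2$3) * B$3$2 +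
     (A$1$1 * A$2$2 - A$1$2 * A$2$1) * B$3$3"

lemma has_field_derivative_det_3:
  fixes A B :: "real ^ 3 ^ 3"
  shows "((\<lambda>t. det (A + t *\<^sub>R B)) has_field_derivative det_deriv A B) (at 0)"
  unfolding det_3 det_deriv_def
  by (auto simp: algebra_simps intro!: derivative_eq_intros)

text \<open>The adjugate of a singular symmetric matrix is a multiple of \<open>S S\<^sup>T\<close> for \<open>S\<close> in its kernel.\<close>

lemma det_deriv_singular_symmetric:
  fixes A :: "real ^ 3 ^ 3"
  assumes sym: "transpose A = A" and ker: "A *v S = 0" and "S \<noteq> 0"
  obtains c where "\<And>B. det_deriv A B = c * (S \<bullet> (B *v S))"
proof -
  have s: "A$2$1 = A$1$2" "A$3$1 = A$1$3" "A$3$2 = A$2$3"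
    using sym by (simp_all add: transpose_def vec_eq_iff)
  have e: "A$1$1 * S$1 + A$1$2 * S$2 + A$1$3 * S$3 = 0"
     "A$1$2 * S$1 + A$2$2 * S$2 + A$2$3 * S$3 = 0"
     "A$1$3 * S$1 + A$2$3 * S$2 + A$3$3 * S$3 = 0"
    using ker by (simp_all add: matrix_vector_mult_def vec_eq_iff forall_3 sum_3 s)
  have q: "S \<bullet> (B *v S) = B$1$1 * (S$1)^2 + B$1$2 * S$1 * S$2 + B$1$3 * S$1 * S$3
     + B$2$1 * S$2 * S$1 + B$2$2 * (S$2)^2 + B$2$3 * S$2 * S$3
     + B$3$1 * S$3 * S$1 + B$3$2 * S$3 * S$2 + B$3$3 * (S$3)^2" for B
    by (simp add: inner_vec_def matrix_vector_mult_def sum_3 algebra_simps power2_eq_square)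
  \<comment> \<open>If adj(A) = c S S^T, its i-th diagonal entry is c (S_i)^2. So c is the i-th
    principal cofactor divided by (S_i)^2, for any i with S_i nonzero.\<close>
  consider "S$1 \<noteq> 0" | "S$2 \<noteq> 0" | "S$3 \<noteq> 0"
    using \<open>S \<noteq> 0\<close> by (auto simp: vec_eq_iff forall_3)
  then show thesis
  proof cases
    case 1
    have "(S$1)^2 * det_deriv A B = (A$2$2 * A$3$3 - A$2$3 * A$2$3) * (S \<bullet> (B *v S))" for B
      unfolding q det_deriv_def s using e by algebra
    then have "det_deriv A B = (A$2$2 * A$3$3 - A$2$3 * A$2$3) / (S$1)^2 * (S \<bullet> (B *v S))" for B
      using 1 by (simp add: field_simps)
    then show thesis by (rule that)
  next
    case 2
    have "(S$2)^2 * det_deriv A B = (A$1$1 * A$3$3 - A$1$3 * A$1$3) * (S \<bullet> (B *v S))" for B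
      unfolding q det_deriv_def s using e by algebra
    then have "det_deriv A B = (A$1$1 * A$3$3 - A$1$3 * A$1$3) / (S$2)^2 * (S \<bullet> (B *v S))" for B
      using 2 by (simp add: field_simps)
    then show thesis by (rule that)
  next
    case 3
    have "(S$3)^2 * det_deriv A B = (A$1$1 * A$2$2 - A$1$2 * A$1$2) * (S \<bullet> (B *v S))" for B
      unfolding q det_deriv_def s using e by algebra
    then have "det_deriv A B = (A$1$1 * A$2$2 - A$1$2 * A$1$2) / (S$3)^2 * (S \<bullet> (B *v S))" for B
      using 3 by (simp add: field_simps)
    then show thesis by (rule that)
  qed
qed

text \<open>The matrix on the left is U N U^T, where U has the rows \<open>u i\<close>. This permits
  computing a Hesse determinant in an adapted basis.\<close>

lemma det_congruence_3:
  fixes N :: "real ^ 3 ^ 3" and u :: "3 \<Rightarrow> real ^ 3"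
  shows "det (\<chi> i j. u i \<bullet> (N *v u j)) = (det (\<chi> i. u i))\<^sup>2 * det N"
proof -
  have "(\<chi> i j. u i \<bullet> (N *v u j)) = (\<chi> i. u i) ** N ** transpose (\<chi> i. u i)"
    by (simp add: vec_eq_iff matrix_matrix_mult_def matrix_vector_mult_def inner_vec_def
        transpose_def sum_3 algebra_simps)
  then show ?thesis by (simp add: det_mul power2_eq_square)
qed

text \<open>A kernel vector of the transpose is a linear relation between the three vectors. The
  coefficient of \<open>X\<close> in it is nonzero, as \<open>Y\<close> and \<open>Z\<close>
  represent different points.\<close>

lemma in_span_if_det_eq_0:
  fixes X Y Z :: "real ^ 3"
  assumes det: "det (vector [X, Y, Z] :: real ^ 3 ^ 3) = 0"
    and nz: "Y \<noteq> 0" "Z \<noteq> 0" and ne: "proj_pt Z \<noteq> proj_pt Y"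
  obtains y z where "X = y *\<^sub>R Y + z *\<^sub>R Z"
proof -
  have "det (transpose (vector [X, Y, Z] :: real ^ 3 ^ 3)) = 0" using det by simp
  then obtain v where v: "v \<noteq> 0" "transpose (vector [X, Y, Z] :: real ^ 3 ^ 3) *v v = 0"
    by (metis invertible_det_nz invertible_left_inverse matrix_left_invertible_ker)
  have dep: "v$1 *\<^sub>R X + v$2 *\<^sub>R Y + v$3 *\<^sub>R Z = 0"
    using v(2) by (simp add: vec_eq_iff forall_3 transpose_def matrix_vector_mult_def sum_3 mult_ac)
  have "v$1 \<noteq> 0"
  proof
    assume 0: "v$1 = 0"
    have 3: "v$3 \<noteq> 0"
      using dep v(1) nz 0 by (auto simp: vec_eq_iff[of v] forall_3)
    have "Z = - (v$2 / v$3) *\<^sub>R Y"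
      using dep 0 3 by (simp add: vec_eq_iff field_simps) (smt (verit))
    moreover from this have "- (v$2 / v$3) \<noteq> 0" using nz by auto
    ultimately show False
      using ne unfolding proj_pt_eq_iff scalar_mult_eq_scaleR by blast
  qed
  then have "X = - (v$2 / v$1) *\<^sub>R Y + - (v$3 / v$1) *\<^sub>R Z"
    using dep by (simp add: vec_eq_iff field_simps) (smt (verit))
  then show thesis by (rule that)
qed

section \<open>Derivatives of a cubic form\<close>

text \<open>Naming the ten coefficients reduces facts about derivatives to polynomial identities in
  coordinates.\<close>

lemma cubic_form_coeffs:
  assumes "cubic_form f"
  obtains a b c d e g h i j k :: real where
    "\<And>X. f X = a * (X$1)^3 + b * (X$2)^3 + c * (X$3)^3 + d * (X$1)^2 * X$2 + e * (X$1)^2 * X$3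
      + g * X$1 * (X$2)^2 + h * (X$2)^2 * X$3 + i * X$1 * (X$3)^2 + j * X$2 * (X$3)^2
      + k * X$1 * X$2 * X$3"
proof -
  obtain c :: "nat \<Rightarrow> nat \<Rightarrow> real" where c: "\<And>X. f X =
        (\<Sum>i\<le>3. \<Sum>j\<le>3 - i. c i j * (X $ 1) ^ i * (X $ 2) ^ j * (X $ 3) ^ (3 - i - j))"
    using assms unfolding cubic_form_def by blast
  show thesis
    by (rule that[of "c 3 0" "c 0 3" "c 0 0" "c 2 1" "c 2 0" "c 1 2" "c 0 2" "c 1 0" "c 0 1" "c 1 1"])
      (simp add: c numeral_3_eq_3 numeral_2_eq_2 algebra_simps)
qed

lemma cubic_derivatives:
  assumes f: "\<And>X. f X = a * (X$1)^3 + b * (X$2)^3 + c * (X$3)^3 + d * (X$1)^2 * X$2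
      + e * (X$1)^2 * X$3 + g * X$1 * (X$2)^2 + h * (X$2)^2 * X$3 + i * X$1 * (X$3)^2
      + j * X$2 * (X$3)^2 + k * X$1 * X$2 * X$3"
  shows gradient_cubic: "gradient f X = vector
    [3 * a * (X$1)^2 + 2 * d * X$1 * X$2 + 2 * e * X$1 * X$3 + g * (X$2)^2 + i * (X$3)^2 + k * X$2 * X$3,
     3 * b * (X$2)^2 + d * (X$1)^2 + 2 * g * X$1 * X$2 + 2 * h * X$2 * X$3 + j * (X$3)^2 + k * X$1 * X$3,
     3 * c * (X$3)^2 + e * (X$1)^2 + h * (X$2)^2 + 2 * i * X$1 * X$3 + 2 * j * X$2 * X$3 + k * X$1 * X$2]"
    and hesse_matrix_cubic: "hesse_matrix f X = vector
    [vector [6 * a * X$1 + 2 * d * X$2 + 2 * e * X$3,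
       2 * d * X$1 + 2 * g * X$2 + k * X$3,
       2 * e * X$1 + 2 * i * X$3 + k * X$2],
     vector [2 * d * X$1 + 2 * g * X$2 + k * X$3,
       6 * b * X$2 + 2 * g * X$1 + 2 * h * X$3,
       2 * h * X$2 + 2 * j * X$3 + k * X$1],
     vector [2 * e * X$1 + 2 * i * X$3 + k * X$2,
       2 * h * X$2 + 2 * j * X$3 + k * X$1,
       6 * c * X$3 + 2 * i * X$1 + 2 * j * X$2]]"
proof -
  have ax: "axis (1::3) (1::real) $ 1 = 1" "axis (1::3) (1::real) $ 2 = 0"
    "axis (1::3) (1::real) $ 3 = 0" "axis (2::3) (1::real) $ 1 = 0"
    "axis (2::3) (1::real) $ 2 = 1" "axis (2::3) (1::real) $ 3 = 0"
    "axis (3::3) (1::real) $ 1 = 0" "axis (3::3) (1::real) $ 2 = 0"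
    "axis (3::3) (1::real) $ 3 = 1"
    by (simp_all add: axis_def)
  \<comment> \<open>The first derivatives are found as functions, because the Hesse entries
    differentiate them again.\<close>
  have 1: "partial_deriv 1 f = (\<lambda>X. 3 * a * (X$1)^2 + 2 * d * X$1 * X$2 + 2 * e * X$1 * X$3 + g * (X$2)^2 + i * (X$3)^2 + k * X$2 * X$3)"
    unfolding partial_deriv_def f
    by (intro ext DERIV_imp_deriv) (auto simp: ax algebra_simps intro!: derivative_eq_intros)
  have 2: "partial_deriv 2 f = (\<lambda>X. 3 * b * (X$2)^2 + d * (X$1)^2 + 2 * g * X$1 * X$2 + 2 * h * X$2 * X$3 + j * (X$3)^2 + k * X$1 * X$3)"
    unfolding partial_deriv_def f
    by (intro ext DERIV_imp_deriv) (auto simp: ax algebra_simps intro!: derivative_eq_intros)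
  have 3: "partial_deriv 3 f = (\<lambda>X. 3 * c * (X$3)^2 + e * (X$1)^2 + h * (X$2)^2 + 2 * i * X$1 * X$3 + 2 * j * X$2 * X$3 + k * X$1 * X$2)"
    unfolding partial_deriv_def f
    by (intro ext DERIV_imp_deriv) (auto simp: ax algebra_simps intro!: derivative_eq_intros)
  show "gradient f X = vector
    [3 * a * (X$1)^2 + 2 * d * X$1 * X$2 + 2 * e * X$1 * X$3 + g * (X$2)^2 + i * (X$3)^2 + k * X$2 * X$3,
     3 * b * (X$2)^2 + d * (X$1)^2 + 2 * g * X$1 * X$2 + 2 * h * X$2 * X$3 + j * (X$3)^2 + k * X$1 * X$3,
     3 * c * (X$3)^2 + e * (X$1)^2 + h * (X$2)^2 + 2 * i * X$1 * X$3 + 2 * j * X$2 * X$3 + k * X$1 * X$2]"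
    by (simp add: gradient_def vec_eq_iff forall_3 1 2 3)
  have "hesse_matrix f X $ m $ n = partial_deriv m (partial_deriv n f) X" for m n
    by (simp add: hesse_matrix_def)
  note entry = this
  have "hesse_matrix f X $ 1 $ 1 = 6 * a * X$1 + 2 * d * X$2 + 2 * e * X$3"
    and "hesse_matrix f X $ 1 $ 2 = 2 * d * X$1 + 2 * g * X$2 + k * X$3"
    and "hesse_matrix f X $ 1 $ 3 = 2 * e * X$1 + 2 * i * X$3 + k * X$2"
    and "hesse_matrix f X $ 2 $ 1 = 2 * d * X$1 + 2 * g * X$2 + k * X$3"
    and "hesse_matrix f X $ 2 $ 2 = 6 * b * X$2 + 2 * g * X$1 + 2 * h * X$3"
    and "hesse_matrix f X $ 2 $ 3 = 2 * h * X$2 + 2 * j * X$3 + k * X$1"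
    and "hesse_matrix f X $ 3 $ 1 = 2 * e * X$1 + 2 * i * X$3 + k * X$2"
    and "hesse_matrix f X $ 3 $ 2 = 2 * h * X$2 + 2 * j * X$3 + k * X$1"
    and "hesse_matrix f X $ 3 $ 3 = 6 * c * X$3 + 2 * i * X$1 + 2 * j * X$2"
    unfolding entry 1 2 3
    by (unfold partial_deriv_def)
      (intro DERIV_imp_deriv; auto simp: ax algebra_simps intro!: derivative_eq_intros)+
  then show "hesse_matrix f X = vector
    [vector [6 * a * X$1 + 2 * d * X$2 + 2 * e * X$3,
       2 * d * X$1 + 2 * g * X$2 + k * X$3,
       2 * e * X$1 + 2 * i * X$3 + k * X$2],
     vector [2 * d * X$1 + 2 * g * X$2 + k * X$3,
       6 * b * X$2 + 2 * g * X$1 + 2 * h * X$3,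
       2 * h * X$2 + 2 * j * X$3 + k * X$1],
     vector [2 * e * X$1 + 2 * i * X$3 + k * X$2,
       2 * h * X$2 + 2 * j * X$3 + k * X$1,
       6 * c * X$3 + 2 * i * X$1 + 2 * j * X$2]]"
    by (simp add: vec_eq_iff forall_3)
qed

lemma transpose_hesse_matrix:
  assumes "cubic_form f"
  shows "transpose (hesse_matrix f X) = hesse_matrix f X"
  by (rule cubic_form_coeffs[OF assms])
    (simp add: hesse_matrix_cubic transpose_def vec_eq_iff forall_3)

lemma hesse_matrix_add:
  assumes "cubic_form f"
  shows "hesse_matrix f (X + Y) = hesse_matrix f X + hesse_matrix f Y"
  by (rule cubic_form_coeffs[OF assms])
    (simp add: hesse_matrix_cubic vec_eq_iff forall_3 algebra_simps)

lemma hesse_matrix_scaleR: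
  assumes "cubic_form f"
  shows "hesse_matrix f (x *\<^sub>R X) = x *\<^sub>R hesse_matrix f X"
  by (rule cubic_form_coeffs[OF assms])
    (simp add: hesse_matrix_cubic vec_eq_iff forall_3 algebra_simps)

text \<open>Both sides contract the constant, symmetric array of third partial derivatives of
  \<open>f\<close> with \<open>X\<close> and \<open>Y\<close>.\<close>

lemma hesse_matrix_mult_commute:
  assumes "cubic_form f"
  shows "hesse_matrix f X *v Y = hesse_matrix f Y *v X"
  by (rule cubic_form_coeffs[OF assms])
    (simp add: hesse_matrix_cubic matrix_vector_mult_def sum_3 vec_eq_iff forall_3 algebra_simps)

text \<open>Euler's relation for the first partial derivatives, which are homogeneous of degree
  2.\<close>

lemma hesse_matrix_mult_self:
  assumes "cubic_form f"
  shows "hesse_matrix f X *v X = 2 *\<^sub>R gradient f X"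
  by (rule cubic_form_coeffs[OF assms])
    (simp add: hesse_matrix_cubic gradient_cubic matrix_vector_mult_def sum_3 vec_eq_iff forall_3
      algebra_simps power2_eq_square)

lemma hesse_det_scaleR:
  assumes "cubic_form f"
  shows "hesse_det f (c *\<^sub>R X) = c ^ 3 * hesse_det f X"
  by (simp add: hesse_det_def hesse_matrix_scaleR[OF assms] det_3 algebra_simps power3_eq_cube)

lemma hesse_det_eq_0_iff: "hesse_det f X = 0 \<longleftrightarrow> (\<exists>Y. Y \<noteq> 0 \<and> hesse_matrix f X *v Y = 0)"
  unfolding hesse_det_def
  by (metis invertible_det_nz invertible_left_inverse matrix_left_invertible_ker)

text \<open>Chain rule: the Hesse matrix is linear in the point, so moving along \<open>Y\<close>
  moves the matrix along \<open>hesse_matrix f Y\<close>.\<close>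

lemma gradient_hesse_det:
  assumes "cubic_form f"
  shows "gradient (hesse_det f) X \<bullet> Y = det_deriv (hesse_matrix f X) (hesse_matrix f Y)"
proof -
  have g: "gradient (hesse_det f) X $ i
      = det_deriv (hesse_matrix f X) (hesse_matrix f (axis i 1))" for i
    unfolding gradient_def partial_deriv_def hesse_det_def hesse_matrix_add[OF assms]
      hesse_matrix_scaleR[OF assms]
    by (simp add: DERIV_imp_deriv has_field_derivative_det_3)
  have "Y = Y$1 *\<^sub>R axis 1 1 + Y$2 *\<^sub>R axis 2 1 + Y$3 *\<^sub>R axis 3 1"
    by (simp add: vec_eq_iff forall_3 axis_def)
  then have "hesse_matrix f Y = Y$1 *\<^sub>R hesse_matrix f (axis 1 1)
      + Y$2 *\<^sub>R hesse_matrix f (axis 2 1) + Y$3 *\<^sub>R hesse_matrix f (axis 3 1)"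
    by (metis hesse_matrix_add[OF assms] hesse_matrix_scaleR[OF assms])
  then show ?thesis
    by (simp add: inner_vec_def sum_3 g det_deriv_def algebra_simps)
qed

section \<open>The symmetric trilinear form of a cubic\<close>

text \<open>For a cubic form this is six times the full polarization of \<open>f\<close>: its value
  at (X, X, X) is \<open>6 * f X\<close>.\<close>

definition hesse_form :: "(real ^ 3 \<Rightarrow> real) \<Rightarrow> real ^ 3 \<Rightarrow> real ^ 3 \<Rightarrow> real ^ 3 \<Rightarrow> real" where
  "hesse_form f X Y Z = Y \<bullet> (hesse_matrix f X *v Z)"

text \<open>The first swap is the symmetry of the Hesse matrix, the second is
  \<open>hesse_matrix_mult_commute\<close>; together they generate the third.\<close>

lemma hesse_form_commute:
  assumes "cubic_form f"
  shows "hesse_form f X Y Z = hesse_form f X Z Y" "hesse_form f X Y Z = hesse_form f Z Y X"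
    "hesse_form f X Y Z = hesse_form f Y X Z"
proof -
  show 1: "hesse_form f X Y Z = hesse_form f X Z Y" for X Y Z
    unfolding hesse_form_def
    by (metis dot_lmul_matrix inner_commute transpose_hesse_matrix[OF assms] transpose_matrix_vector)
  show 2: "hesse_form f X Y Z = hesse_form f Z Y X" for X Y Z
    unfolding hesse_form_def by (simp add: hesse_matrix_mult_commute[OF assms, of X Z])
  show "hesse_form f X Y Z = hesse_form f Y X Z"
    by (metis 1 2)
qed

lemma hesse_form_left:
  assumes "cubic_form f"
  shows "hesse_form f (x *\<^sub>R X + y *\<^sub>R Y) Z W = x * hesse_form f X Z W + y * hesse_form f Y Z W"
  by (simp add: hesse_form_def hesse_matrix_add[OF assms] hesse_matrix_scaleR[OF assms]
      matrix_vector_mult_add_rdistrib scaleR_matrix_vector_assoc[symmetric] inner_add_right)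

text \<open>With \<open>P\<close> moved to the middle slot, Euler's relation applies to
  \<open>R\<close>. Hence, at a nonsingular point \<open>R\<close> of the cubic, lying on the polar
  conic of \<open>P\<close> means that the tangent at \<open>R\<close> passes through
  \<open>P\<close>.\<close>

lemma hesse_form_contact:
  assumes "cubic_form f"
  shows "hesse_form f P R R = 2 * (gradient f R \<bullet> P)"
proof -
  have "hesse_form f P R R = hesse_form f R P R"
    using hesse_form_commute(3)[OF assms] .
  then show ?thesis
    by (simp add: hesse_form_def hesse_matrix_mult_self[OF assms] inner_commute)
qed

lemma hesse_form_kernel:
  assumes "cubic_form f" "hesse_matrix f X *v S = 0"
  shows "hesse_form f X S Y = 0" "hesse_form f X Y S = 0" "hesse_form f Y X S = 0"
    "hesse_form f Y S X = 0" "hesse_form f S X Y = 0" "hesse_form f S Y X = 0"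
proof -
  show "hesse_form f X Y S = 0" by (simp add: hesse_form_def assms)
  then show "hesse_form f X S Y = 0" "hesse_form f Y X S = 0"
    "hesse_form f Y S X = 0" "hesse_form f S X Y = 0" "hesse_form f S Y X = 0"
    by (simp_all add: hesse_form_commute(1)[OF assms(1), of X S Y]
        hesse_form_commute(3)[OF assms(1), of Y X S] hesse_form_commute(2)[OF assms(1), of Y S X]
        hesse_form_commute(3)[OF assms(1), of S X Y] hesse_form_commute(2)[OF assms(1), of S Y X])
qed

text \<open>In the basis \<open>S, R, V\<close> the Hesse matrix of \<open>x R + y V\<close> has first row \<open>(0, 0, y D)\<close>,
  where \<open>D = hesse_form f V S V\<close>.\<close>

lemma hesse_det_on_tangent:
  assumes f: "cubic_form f" and ker: "hesse_matrix f R *v S = 0" and tan: "hesse_form f V S S = 0"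
  shows "(det (vector [S, R, V] :: real ^ 3 ^ 3))\<^sup>2 * hesse_det f (x *\<^sub>R R + y *\<^sub>R V) =
    - (y\<^sup>2 * (hesse_form f V S V)\<^sup>2 * (x * hesse_form f R R R + y * hesse_form f V R R))"
proof -
  define u :: "3 \<Rightarrow> real ^ 3" where "u = (\<lambda>i. (vector [S, R, V] :: real ^ 3 ^ 3) $ i)"
  have u: "u 1 = S" "u 2 = R" "u 3 = V" "(\<chi> i. u i) = vector [S, R, V]"
    by (simp_all add: u_def vec_eq_iff)
  define W where "W = x *\<^sub>R R + y *\<^sub>R V"
  note W = hesse_form_left[OF f, of x R y V, folded W_def]
  note k = hesse_form_kernel[OF f ker]
  note c = hesse_form_commute[OF f]
  have "(det (vector [S, R, V] :: real ^ 3 ^ 3))\<^sup>2 * hesse_det f W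
      = det (\<chi> i j. hesse_form f W (u i) (u j))"
    unfolding hesse_det_def hesse_form_def det_congruence_3 u ..
  also have "\<dots> = - (y\<^sup>2 * (hesse_form f V S V)\<^sup>2
      * (x * hesse_form f R R R + y * hesse_form f V R R))"
  proof -
    \<comment> \<open>By symmetry the first column is also (0, 0, y D), so the determinant is -(y
      D)^2 times the entry at (R, R).\<close>
    have "hesse_form f W S S = 0" "hesse_form f W S R = 0" "hesse_form f W R S = 0"
      "hesse_form f W S V = y * hesse_form f V S V" "hesse_form f W V S = y * hesse_form f V S V"
      "hesse_form f W R R = x * hesse_form f R R R + y * hesse_form f V R R"
      by (simp_all add: W k tan c(1)[of V V S])
    then show ?thesis
      by (simp add: det_3 u power2_eq_square algebra_simps)
  qed
  finally show ?thesis unfolding W_def .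
qed

text \<open>The equation \<open>hesse_form f P R R = 0\<close> puts \<open>R\<close> on the polar
  conic of \<open>P\<close>, hence on one of its two lines.\<close>

lemma third_contact_hesse:
  assumes f: "cubic_form f" and P: "P \<noteq> 0" "hesse_det f P = 0"
    and r: "r \<in> third_contact_pts (hesse_det f) (proj_pt P)"
  obtains R where "R \<noteq> 0" "r = proj_pt R" "hesse_det f R = 0" "hesse_form f P R R = 0"
proof -
  define h where "h = hesse_det f"
  obtain R\<^sub>0 l where R0: "R\<^sub>0 \<noteq> 0" "r = proj_pt R\<^sub>0" "h R\<^sub>0 = 0" "gradient h R\<^sub>0 \<noteq> 0"
    and l: "l = proj_line (gradient h R\<^sub>0)" "proj_pt P \<in> l"
    and mult: "\<And>q. q \<in> l \<Longrightarrow>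
      intersection_mult h l q (2 * of_bool (q = r) + of_bool (q = proj_pt P))"
    using r unfolding third_contact_pts_def is_tangent_def h_def by blast
  define G where "G = gradient h R\<^sub>0"
  have on_l: "proj_pt X \<in> l \<longleftrightarrow> G \<bullet> X = 0" if "X \<noteq> 0" for X
    using that by (simp add: l G_def proj_pt_mem_line_iff lin_form_real)
  have h_proj: "h X = 0 \<longleftrightarrow> h Y = 0" if "proj_pt X = proj_pt Y" for X Y
    using that unfolding proj_pt_eq_iff scalar_mult_eq_scaleR
    by (auto simp: h_def hesse_det_scaleR[OF f])
  obtain S where S: "S \<noteq> 0" "hesse_matrix f R\<^sub>0 *v S = 0"
    using R0 hesse_det_eq_0_iff unfolding h_def by blast
  obtain c where "\<And>B. det_deriv (hesse_matrix f R\<^sub>0) B = c * (S \<bullet> (B *v S))"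
    using det_deriv_singular_symmetric[OF transpose_hesse_matrix[OF f] S(2,1)] by blast
  then have c: "G \<bullet> Y = c * hesse_form f Y S S" for Y
    by (simp add: G_def h_def gradient_hesse_det[OF f] hesse_form_def)
  \<comment> \<open>At \<open>Y = G\<close> the left side is the squared norm of the nonzero
    gradient.\<close>
  have "c \<noteq> 0" using c[of G] R0(4) by (auto simp: G_def)
  have "G \<bullet> R\<^sub>0 = 0" by (simp add: c hesse_form_def S)
  then have "r \<in> l" using on_l R0 by simp
  \<comment> \<open>The multiplicity at \<open>r\<close> brings its own representative
    \<open>R\<close>, possibly a multiple of \<open>R\<^sub>0\<close>; the facts about
    \<open>R\<^sub>0\<close> are carried over to it.\<close>
  from mult[OF this] obtain R V \<phi> where R: "R \<noteq> 0" "r = proj_pt R"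
    and V: "V \<noteq> 0" "proj_pt V \<in> l" "proj_pt V \<noteq> r"
    and \<phi>: "\<phi> \<noteq> 0" "\<And>t. poly \<phi> t = h (R + t *\<^sub>R V)"
      "order 0 \<phi> = 2 + of_bool (r = proj_pt P)"
    unfolding intersection_mult_def by auto
  have hR: "h R = 0" using h_proj R R0 by metis
  have ker: "hesse_matrix f R *v S = 0"
  proof -
    obtain d where "R = d *\<^sub>R R\<^sub>0"
      using R R0 by (metis proj_pt_eqE)
    then show ?thesis
      by (simp add: hesse_matrix_scaleR[OF f] scaleR_matrix_vector_assoc[symmetric] S)
  qed
  have perp: "G \<bullet> R = 0" "G \<bullet> V = 0" "G \<bullet> P = 0"
    using on_l \<open>r \<in> l\<close> R V l(2) P by auto
  have tan: "hesse_form f V S S = 0" using c[of V] \<open>c \<noteq> 0\<close> perp by simp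
  have "hesse_form f P R R = 0"
  proof (cases "det (vector [S, R, V] :: real ^ 3 ^ 3) = 0")
    case True
    then obtain y z where "S = y *\<^sub>R R + z *\<^sub>R V"
      using in_span_if_det_eq_0 R V by metis
    then have Sl: "proj_pt S \<in> l" using on_l[OF S(1)] perp by (simp add: inner_add_right)
    have hS: "h S = 0"
      unfolding h_def hesse_det_eq_0_iff
      using R(1) ker hesse_matrix_mult_commute[OF f] by metis
    \<comment> \<open>As \<open>h\<close> vanishes at \<open>S\<close>, the multiplicity there is
      positive, and the prescribed multiplicities are positive only at \<open>r\<close> and at the
      point of \<open>P\<close>.\<close>
    obtain S' V' \<psi> where "proj_pt S = proj_pt S'" "\<psi> \<noteq> 0" "\<And>t. poly \<psi> t = h (S' + t *\<^sub>R V')"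
      and o: "order 0 \<psi> = 2 * of_bool (proj_pt S = r) + of_bool (proj_pt S = proj_pt P)"
      using mult[OF Sl] unfolding intersection_mult_def by blast
    then have "poly \<psi> 0 = 0" using h_proj[of S S'] hS by simp
    with \<open>\<psi> \<noteq> 0\<close> o have "proj_pt S = r \<or> proj_pt S = proj_pt P"
      by (auto simp: order_root)
    then show ?thesis
    proof
      assume "proj_pt S = r"
      then obtain d where "R = d *\<^sub>R S"
        using R by (metis proj_pt_eqE)
      then have "hesse_matrix f R *v R = 0"
        using ker by (metis matrix_vector_mult_scaleR scaleR_zero_right)
      then show ?thesis by (rule hesse_form_kernel(3)[OF f])
    next
      assume "proj_pt S = proj_pt P"
      then obtain d where "P = d *\<^sub>R S"
        by (metis proj_pt_eqE)
      then have "hesse_matrix f R *v P = 0"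
        using ker by (metis matrix_vector_mult_scaleR scaleR_zero_right)
      then show ?thesis by (rule hesse_form_kernel(5)[OF f])
    qed
  next
    case False
    define \<delta> where "\<delta> = (det (vector [S, R, V] :: real ^ 3 ^ 3))\<^sup>2"
    define A B D where "A = hesse_form f R R R" and "B = hesse_form f V R R"
      and "D = (hesse_form f V S V)\<^sup>2"
    have "\<delta> \<noteq> 0" using False by (simp add: \<delta>_def)
    have restr: "\<delta> * h (x *\<^sub>R R + y *\<^sub>R V) = - (y\<^sup>2 * D * (x * A + y * B))" for x y
      unfolding \<delta>_def A_def B_def D_def h_def by (rule hesse_det_on_tangent[OF f ker tan])
    \<comment> \<open>In the chart x = 1, t^2 accounts for the tangency at \<open>R\<close>, and A +
      t B is the residual linear factor.\<close>
    have "poly (smult \<delta> \<phi>) t = poly [:0, 0, - (D * A), - (D * B):] t" for t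
      using restr[of 1 t] by (simp add: \<phi>(2) algebra_simps power2_eq_square)
    then have \<phi>_eq: "smult \<delta> \<phi> = [:0, 0, - (D * A), - (D * B):]"
      by (intro poly_eqI_degree_lead_coeff poly_ext)
    \<comment> \<open>Otherwise the whole tangent would lie on the curve, contradicting
      \<open>\<phi> \<noteq> 0\<close>.\<close>
    have "D \<noteq> 0"
      using \<phi>_eq \<phi>(1) \<open>\<delta> \<noteq> 0\<close> by auto
    \<comment> \<open>All three vectors are orthogonal to \<open>G\<close>, so \<open>P\<close>
      acquires coordinates x, y with respect to \<open>R\<close> and \<open>V\<close>.\<close>
    have "det (vector [P, R, V] :: real ^ 3 ^ 3) = 0"
    proof -
      have "(vector [P, R, V] :: real ^ 3 ^ 3) *v G = 0"
        using perp by (simp add: vec_eq_iff forall_3 matrix_vector_mul_component inner_commute)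
      moreover have "G \<noteq> 0" using R0 by (simp add: G_def)
      ultimately show ?thesis
        by (metis invertible_det_nz invertible_left_inverse matrix_left_invertible_ker)
    qed
    then obtain x y where xy: "P = x *\<^sub>R R + y *\<^sub>R V"
      using in_span_if_det_eq_0 R V by metis
    have form: "hesse_form f P R R = x * A + y * B"
      unfolding xy hesse_form_left[OF f] A_def B_def ..
    show ?thesis
    proof (cases "r = proj_pt P")
      case True
      \<comment> \<open>In the inflection case the order at \<open>R\<close> is 3, which kills the
        coefficient of t^2 and hence \<open>A\<close>; here \<open>P\<close> is a multiple of
        \<open>R\<close>.\<close>
      then have "monom 1 3 dvd \<phi>" using \<phi> by (simp add: monom_1_dvd_iff)
      then have "coeff \<phi> 2 = 0" by (simp add: monom_1_dvd_iff')
      moreover have "coeff (smult \<delta> \<phi>) 2 = - (D * A)"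
        unfolding \<phi>_eq by (simp add: numeral_2_eq_2)
      ultimately have "A = 0" using \<open>D \<noteq> 0\<close> by simp
      obtain d where d: "P = d *\<^sub>R R"
        using True R by (metis proj_pt_eqE)
      have "hesse_form f P R R = d * A"
        using hesse_form_left[OF f, of d R 0 R R R] d by (simp add: A_def)
      then show ?thesis using \<open>A = 0\<close> by simp
    next
      case False
      have "y \<noteq> 0"
      proof
        assume "y = 0"
        then have "P = x *\<^sub>R R" "x \<noteq> 0" using xy P by auto
        then have "proj_pt P = proj_pt R"
          unfolding proj_pt_eq_iff scalar_mult_eq_scaleR by blast
        then show False using False R by simp
      qed
      \<comment> \<open>Since \<open>h\<close> vanishes at \<open>P\<close>, the nonzero factor
        \<open>y\<^sup>2 * D\<close> cancels and leaves the residual factor at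
        \<open>P\<close>.\<close>
      then show ?thesis
        using restr[of x y] P(2) \<open>D \<noteq> 0\<close> by (simp add: form h_def flip: xy)
    qed
  qed
  then show thesis using that R hR unfolding h_def by blast
qed

section \<open>The polar conic\<close>

lemma polar_form_complexify:
  "polar_form f P (complexify X) = complex_of_real (hesse_form f P X X)"
  by (simp add: polar_form_def hesse_form_def complexify_def inner_vec_def matrix_vector_mult_def
      sum_3 algebra_simps)

text \<open>Both sides are twice the symmetric bilinear form of the polar conic at \<open>X\<close>
  and \<open>Q\<close>. Letting \<open>X\<close> vary relates common points of the two lines to the
  kernel of the Hesse matrix at \<open>P\<close>.\<close>

lemma polar_form_polarization:
  assumes f: "cubic_form f" and ab: "\<And>X. polar_form f P X = lin_form a X * lin_form b X"
  shows "lin_form a X * lin_form b (complexify Q) + lin_form a (complexify Q) * lin_form b X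
    = 2 * lin_form X (complexify (hesse_matrix f P *v Q))"
proof -
  have sym: "hesse_matrix f P $ i $ j = hesse_matrix f P $ j $ i" for i j
    using arg_cong[OF transpose_hesse_matrix[OF f, of P], of "\<lambda>A. A $ j $ i"]
    by (simp add: transpose_def)
  have "lin_form a X * lin_form b (complexify Q) + lin_form a (complexify Q) * lin_form b X
      = polar_form f P (X + complexify Q) - polar_form f P X - polar_form f P (complexify Q)"
    by (simp add: ab lin_form_add algebra_simps)
  also have "\<dots> = 2 * lin_form X (complexify (hesse_matrix f P *v Q))"
    by (simp add: polar_form_def lin_form_def complexify_def matrix_vector_mult_def sum_3
        sym[of 2 1] sym[of 3 1] sym[of 3 2]) algebra
  finally show ?thesis .
qed

theorem theorem7:
  fixes f :: "real ^ 3 \<Rightarrow> real"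
    and p :: "(real ^ 3) set"
    and l\<^sub>1 l\<^sub>2 :: "(complex ^ 3) set set"
  assumes "cubic_form f"
    and "p \<in> hesse_derivative f"
    and "polar_conic_lines f p l\<^sub>1 l\<^sub>2"
  shows "(\<forall>r \<in> contact_pts f p. r \<in> curve f \<and> complex_pt r \<in> l\<^sub>1 \<union> l\<^sub>2) \<and>
         (\<forall>r \<in> third_contact_pts (hesse_det f) p.
            r \<in> hesse_derivative f \<and> complex_pt r \<in> l\<^sub>1 \<union> l\<^sub>2) \<and>
         (l\<^sub>1 \<noteq> l\<^sub>2 \<longrightarrow> (\<exists>q \<in> hesse_derivative f. l\<^sub>1 \<inter> l\<^sub>2 = {complex_pt q})) \<and>
         (\<forall>q \<in> proj_plane. complex_pt q \<in> l\<^sub>1 \<inter> l\<^sub>2 \<longrightarrow> q \<in> hesse_derivative f)"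
proof -
  note f = assms(1)
  obtain P a b where P: "P \<noteq> 0" "p = proj_pt P" and ab0: "a \<noteq> 0" "b \<noteq> 0"
    and l: "l\<^sub>1 = proj_line a" "l\<^sub>2 = proj_line b"
    and ab: "\<And>X. polar_form f P X = lin_form a X * lin_form b X"
    using assms(3) unfolding polar_conic_lines_def by blast
  have on_hesse: "proj_pt X \<in> hesse_derivative f \<longleftrightarrow> hesse_det f X = 0" if "X \<noteq> 0" for X
    unfolding hesse_derivative_def
    using that hesse_det_scaleR[OF f]
    by (intro proj_pt_mem_curve_iff[where n = 3]) (simp_all add: scalar_mult_eq_scaleR)
  have hP: "hesse_det f P = 0" using assms(2) on_hesse P by simp
  have on_lines: "complex_pt (proj_pt X) \<in> l\<^sub>1 \<longleftrightarrow> lin_form a (complexify X) = 0"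
    "complex_pt (proj_pt X) \<in> l\<^sub>2 \<longleftrightarrow> lin_form b (complexify X) = 0" if "X \<noteq> 0" for X
    using that by (simp_all add: l complex_pt_proj_pt proj_pt_mem_line_iff complexify_eq_0_iff)
  have on_union: "complex_pt (proj_pt X) \<in> l\<^sub>1 \<union> l\<^sub>2" if "X \<noteq> 0" "hesse_form f P X X = 0" for X
    using that ab[of "complexify X"] on_lines[OF that(1)] by (simp add: polar_form_complexify)
  note pol = polar_form_polarization[OF f ab]
  have kernel_on_hesse: "proj_pt Q \<in> hesse_derivative f"
    if "Q \<noteq> 0" "hesse_matrix f P *v Q = 0" for Q
    unfolding on_hesse[OF that(1)] hesse_det_eq_0_iff
    using that(2) P(1) hesse_matrix_mult_commute[OF f] by metis
  have "r \<in> curve f \<and> complex_pt r \<in> l\<^sub>1 \<union> l\<^sub>2" if r: "r \<in> contact_pts f p" for r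
  proof -
    obtain R where R: "R \<noteq> 0" "r = proj_pt R" "f R = 0" "p \<in> proj_line (gradient f R)"
      using r unfolding contact_pts_def is_tangent_def by blast
    then have "gradient f R \<bullet> P = 0" using P by (simp add: proj_pt_mem_line_iff lin_form_real)
    then have "hesse_form f P R R = 0" by (simp add: hesse_form_contact[OF f])
    then show ?thesis using on_union R unfolding curve_def by blast
  qed
  moreover have "r \<in> hesse_derivative f \<and> complex_pt r \<in> l\<^sub>1 \<union> l\<^sub>2"
    if "r \<in> third_contact_pts (hesse_det f) p" for r
    using third_contact_hesse[OF f P(1) hP that[unfolded P(2)]] on_union on_hesse by metis
  moreover have "\<exists>q \<in> hesse_derivative f. l\<^sub>1 \<inter> l\<^sub>2 = {complex_pt q}" if ne: "l\<^sub>1 \<noteq> l\<^sub>2"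
  proof -
    \<comment> \<open>The kernel vector is real, so even two non-real lines meet in a real
      point.\<close>
    obtain Q where Q: "Q \<noteq> 0" "hesse_matrix f P *v Q = 0"
      using hP hesse_det_eq_0_iff by blast
    have pol0: "lin_form a X * lin_form b (complexify Q) + lin_form a (complexify Q) * lin_form b X = 0" for X
      unfolding pol Q by (simp add: complexify_def lin_form_def)
    have Q0: "lin_form a (complexify Q) = 0 \<and> lin_form b (complexify Q) = 0"
    proof (rule ccontr)
      assume nz: "\<not> ?thesis"
      \<comment> \<open>Basis vectors show that b(Q) a = -a(Q) b, writing a(Q), b(Q) for the two
        values. As \<open>a\<close> and \<open>b\<close> are nonzero, one nonzero value forces the
        other, and the lines coincide.\<close>
      have coords: "a $ i * lin_form b (complexify Q) + lin_form a (complexify Q) * b $ i = 0" for i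
        using pol0[of "axis i 1"] by (simp add: lin_form_axis)
      have "lin_form a (complexify Q) \<noteq> 0 \<and> lin_form b (complexify Q) \<noteq> 0"
      proof -
        obtain i j where "a $ i \<noteq> 0" "b $ j \<noteq> 0" using ab0 by (auto simp: vec_eq_iff)
        then show ?thesis using coords[of i] coords[of j] nz by fastforce
      qed
      then have "lin_form a X = 0 \<longleftrightarrow> lin_form b X = 0" for X
        using pol0[of X] by (metis add.right_neutral add_0 mult_eq_0_iff)
      then show False using ne unfolding l proj_line_def curve_def by simp
    qed
    have "z = complex_pt (proj_pt Q)" if z: "z \<in> l\<^sub>1 \<inter> l\<^sub>2" for z
    proof -
      obtain Z where Z: "Z \<noteq> 0" "z = proj_pt Z" "lin_form a Z = 0"
        using z unfolding l proj_line_def curve_def by blast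
      then have "lin_form b Z = 0" using z by (simp add: l proj_pt_mem_line_iff)
      then show ?thesis
        using lines_meet_once[OF ne[unfolded l] ab0 Z(1), of "complexify Q"] Z Q Q0
        by (simp add: complex_pt_proj_pt complexify_eq_0_iff)
    qed
    then have "l\<^sub>1 \<inter> l\<^sub>2 = {complex_pt (proj_pt Q)}" using Q0 on_lines[OF Q(1)] by blast
    then show ?thesis using kernel_on_hesse[OF Q] by blast
  qed
  moreover have "q \<in> hesse_derivative f"
    if q: "q \<in> proj_plane" "complex_pt q \<in> l\<^sub>1 \<inter> l\<^sub>2" for q
  proof -
    obtain Q where Q: "Q \<noteq> 0" "q = proj_pt Q" using q unfolding proj_plane_def by blast
    then have "lin_form a (complexify Q) = 0" "lin_form b (complexify Q) = 0"
      using q on_lines by auto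
    \<comment> \<open>The polarization vanishes for every \<open>X\<close>, so basis vectors put
      \<open>Q\<close> in the kernel. This argument also covers coinciding lines.\<close>
    then have "lin_form X (complexify (hesse_matrix f P *v Q)) = 0" for X
      using pol[of X Q] by simp
    then have "complexify (hesse_matrix f P *v Q) $ i = 0" for i
      using lin_form_axis[of "complexify (hesse_matrix f P *v Q)" i]
      by (simp add: lin_form_def mult.commute)
    then have "hesse_matrix f P *v Q = 0" by (simp add: vec_eq_iff complexify_def)
    then show ?thesis using kernel_on_hesse Q by simp
  qed
  ultimately show ?thesis by blast
qed

end
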